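(* Let $z_k=k(k+1)$ for $k\ge1$, let $\frac{1}{\tilde z_k}=\sum_{i=1}^{k-1}\frac{1}{z_i-z_k}+\sum_{i=k+1}^{\infty}\left(\frac{1}{z_i-z_k}-\frac{1}{z_i}\right)$ and $\tilde\zeta_{\mathcal Z}(s)=\sum_{n\ge1}\frac{1}{\tilde z_nz_n^{s-1}}$. Then $$\frac{1}{\tilde z_k}=\frac1k-\frac{2}{k+1}+\frac{1}{(2k+1)^2},$$ and for every integer $s\ge2$, $$\tilde\zeta_{\mathcal Z}(s)=(-1)^s\left(\sum_{k=2}^{s}\mu^{(s)}_k\zeta(k)+\eta_s\right),$$ where $\zeta$ is the Riemann zeta function, $$\mu^{(s)}_k=\big((-1)^k+2\big)\left\{\binom{2s-2-k}{s-2}+(-1)^k\binom{2s-2-k}{s-1}\right\}-\big(1+(-1)^k\big)\beta^{(s-1)}_{k-1},$$ $$\beta^{(s)}_k=\sum_{i=0}^{s-k-1}4^i\binom{2s-2i-k-2}{s-i-1}\ (\text{empty sum }=0),$$ $$\eta_s=\left(s-\tfrac12\right)\binom{2s-2}{s-1}-\binom{2s-2}{s}-4\binom{2s-3}{s-2}-\left(\frac{\pi^2}{8}-\frac12\right)2^{2s-2}.$$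
   Context: Binomial coefficients $\binom{m}{j}$ with $j>m\ge0$ or $j<0$ are $0$. *)

theory Defs
  imports "HOL-Analysis.Analysis"
begin

definition zseq :: "nat \<Rightarrow> real" where
  "zseq k = real k * (real k + 1)"

(* inv_ztilde k is 1 / z~_k; the term of index j of the series belongs to i = j + k + 1. *)

definition inv_ztilde_term :: "nat \<Rightarrow> nat \<Rightarrow> real" where
  "inv_ztilde_term k i = 1 / (zseq i - zseq k) - 1 / zseq i"

definition inv_ztilde :: "nat \<Rightarrow> real" where
  "inv_ztilde k = (\<Sum>i\<in>{1..<k}. 1 / (zseq i - zseq k)) + (\<Sum>j. inv_ztilde_term k (j + k + 1))"

(* Only integer arguments s \<ge> 2 are used, so that s - 1 is a genuine subtraction;
   the term of index j of the series belongs to n = j + 1. *)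

definition zeta_tilde_term :: "nat \<Rightarrow> nat \<Rightarrow> real" where
  "zeta_tilde_term s n = inv_ztilde n / zseq n ^ (s - 1)"

definition zeta_tilde :: "nat \<Rightarrow> real" where
  "zeta_tilde s = (\<Sum>j. zeta_tilde_term s (j + 1))"

(* The Riemann zeta function at integers k \<ge> 2, where its Dirichlet series converges. *)

definition zeta_nat :: "nat \<Rightarrow> real" where
  "zeta_nat k = (\<Sum>j. 1 / real (j + 1) ^ k)"

(* The index range 0 .. s-k-1 is written i < s - k, which is empty exactly when s \<le> k.
   On it all subtractions in the binomial coefficients are exact. *)

definition beta_coeff :: "nat \<Rightarrow> nat \<Rightarrow> real" where
  "beta_coeff s k =
     (\<Sum>i<s - k. 4 ^ i * real ((2 * s - 2 * i - k - 2) choose (s - i - 1)))"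

(* For 2 \<le> k \<le> s all natural-number subtractions are exact. *)

definition mu_coeff :: "nat \<Rightarrow> nat \<Rightarrow> real" where
  "mu_coeff s k =
     ((-1) ^ k + 2) *
       (real ((2 * s - 2 - k) choose (s - 2)) + (-1) ^ k * real ((2 * s - 2 - k) choose (s - 1)))
     - (1 + (-1) ^ k) * beta_coeff (s - 1) (k - 1)"

definition eta_coeff :: "nat \<Rightarrow> real" where
  "eta_coeff s =
     (real s - 1 / 2) * real ((2 * s - 2) choose (s - 1))
     - real ((2 * s - 2) choose s)
     - 4 * real ((2 * s - 3) choose (s - 2))
     - (pi\<^sup>2 / 8 - 1 / 2) * 2 ^ (2 * s - 2)"

end

theory Submission
  imports Defs
begin

text \<open>
  Put \<open>u = 1/n\<close>, \<open>v = 1/(n+1)\<close> and \<open>q = 1/(2n+1)\<^sup>2\<close>, so that \<open>1/z\<^sub>n = uv\<close>.  The relation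
  \<open>u - v = uv\<close> makes the coefficients of the partial fractions of \<open>u\<^sup>a v\<^sup>b\<close> satisfy Pascal's rule,
  so they are signed binomial coefficients and the sum over \<open>n\<close> is a combination of zeta values.
  The relation \<open>uv q = uv - 4q\<close> reduces \<open>\<Sum> (uv)\<^sup>p q\<close> to such sums and to
  \<open>\<Sum> q = \<pi>\<^sup>2/8 - 1\<close>, which produces the coefficients \<open>\<beta>\<close>.  The closed form of \<open>1/z\<^sup>~\<^sub>k\<close>
  comes from \<open>z\<^sub>i - z\<^sub>k = (i-k)(i+k+1)\<close> by telescoping.
\<close>

section \<open>Partial fractions of products of powers\<close>

lemma partial_fraction_first_power:
  fixes u v :: "'a::comm_ring_1"
  assumes "u - v = u * v"
  shows "u * v ^ Suc b = u - (\<Sum>k=0..b. v ^ Suc k)"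
proof (induction b)
  case 0
  show ?case using assms by simp
next
  case (Suc b)
  have "u * v ^ Suc (Suc b) = v ^ Suc b * (u - v)"
    unfolding assms by (simp add: mult_ac)
  also have "\<dots> = u * v ^ Suc b - v ^ Suc (Suc b)"
    by (simp add: algebra_simps)
  finally show ?case using Suc.IH by simp
qed

text \<open>Replacing one factor \<open>u * v\<close> by \<open>u - v\<close> turns a product into a
  difference of two products with smaller \<open>a + b\<close>, hence the induction on
  \<open>a + b\<close>. The cases \<open>a = 0\<close> and \<open>b = 0\<close> are the boundary of
  the Pascal triangle.\<close>

lemma partial_fraction:
  fixes u v :: "'a::comm_ring_1"
  assumes uv: "u - v = u * v"
  shows "u ^ Suc a * v ^ Suc b =
    (\<Sum>k=0..a. (-1) ^ (a + k) * of_nat ((a + b - k) choose b) * u ^ Suc k)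
    - (-1) ^ a * (\<Sum>k=0..b. of_nat ((a + b - k) choose a) * v ^ Suc k)"
  (is "?F a b = ?A a b - ?B a b")
proof (induction "a + b" arbitrary: a b rule: less_induct)
  case less
  consider "a = 0" | a' where "a = Suc a'" "b = 0" | a' b' where "a = Suc a'" "b = Suc b'"
    by (metis not0_implies_Suc)
  then show ?case
  proof cases
    case 1
    then show ?thesis using partial_fraction_first_power[OF uv, of b] by simp
  next
    case 2
    have "?F (Suc a') 0 = u ^ Suc a' * (u - v)"
      unfolding uv by (simp add: mult_ac)
    also have "\<dots> = u ^ Suc (Suc a') - ?F a' 0"
      by (simp add: algebra_simps)
    also have "?F a' 0 = ?A a' 0 - ?B a' 0"
      using less[of a' 0] 2 by simp
    finally show ?thesis using 2 by (simp add: sum_negf)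
  next
    case 3
    have "?F (Suc a') (Suc b') = u ^ Suc a' * v ^ Suc b' * (u - v)"
      unfolding uv by (simp add: mult_ac)
    also have "\<dots> = ?F (Suc a') b' - ?F a' (Suc b')"
      by (simp add: algebra_simps)
    also have "?F (Suc a') b' = ?A (Suc a') b' - ?B (Suc a') b'"
      using less[of "Suc a'" b'] 3 by simp
    also have "?F a' (Suc b') = ?A a' (Suc b') - ?B a' (Suc b')"
      using less[of a' "Suc b'"] 3 by simp
    also have "?A (Suc a') b' - ?B (Suc a') b' - (?A a' (Suc b') - ?B a' (Suc b'))
      = (?A (Suc a') b' - ?A a' (Suc b')) - (?B (Suc a') b' - ?B a' (Suc b'))"
      by simp
    also have "?A (Suc a') b' - ?A a' (Suc b') = ?A (Suc a') (Suc b')"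
    proof -
      \<comment> \<open>The term \<open>k = Suc a'\<close> comes from the first sum alone and has
        coefficient 1 on both sides. In the others the opposite sign of
        \<open>?A a' (Suc b')\<close> turns the difference into Pascal's rule.\<close>
      have "(\<Sum>k=0..a'. (-1) ^ (Suc a' + k) * of_nat ((Suc a' + b' - k) choose b') * u ^ Suc k)
          - ?A a' (Suc b')
        = (\<Sum>k=0..a'. (-1) ^ (Suc a' + k) * of_nat ((Suc a' + Suc b' - k) choose Suc b') * u ^ Suc k)"
        unfolding sum_subtractf[symmetric]
        by (intro sum.cong refl) (simp add: Suc_diff_le algebra_simps)
      then show ?thesis by simp
    qed
    also have "?B (Suc a') b' - ?B a' (Suc b') = ?B (Suc a') (Suc b')"
    proof -
      \<comment> \<open>Here the unmatched term is \<open>k = Suc b'\<close>, and the factors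
        \<open>(-1) ^ Suc a'\<close> and \<open>(-1) ^ a'\<close> make the difference a sum.\<close>
      have "(\<Sum>k=0..b'. of_nat ((Suc a' + b' - k) choose Suc a') * v ^ Suc k)
          + (\<Sum>k=0..b'. of_nat ((a' + Suc b' - k) choose a') * v ^ Suc k)
        = (\<Sum>k=0..b'. of_nat ((Suc a' + Suc b' - k) choose Suc a') * v ^ Suc k)"
        unfolding sum.distrib[symmetric]
        by (intro sum.cong refl) (simp add: Suc_diff_le algebra_simps)
      from this[symmetric] show ?thesis by (simp add: algebra_simps)
    qed
    finally show ?thesis using 3 by simp
  qed
qed

section \<open>Mixed reciprocal powers and zeta values\<close>

text \<open>Hockey-stick identity. It collects the corrections that arise because the powers of
  \<open>1/(n+2)\<close> sum to a zeta value minus 1.\<close>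

lemma sum_choose_shifted_diagonal:
  "(\<Sum>k=1..b. (a + b - k) choose a) = (a + b) choose Suc a"
proof (induction b)
  case (Suc b)
  have "(\<Sum>k=1..Suc b. (a + Suc b - k) choose a)
      = ((a + b) choose a) + (\<Sum>k=Suc 1..Suc b. (a + Suc b - k) choose a)"
    by (subst sum.atLeast_Suc_atMost) auto
  also have "(\<Sum>k=Suc 1..Suc b. (a + Suc b - k) choose a) = (\<Sum>k=1..b. (a + b - k) choose a)"
    by (subst sum.shift_bounds_cl_Suc_ivl) simp
  finally show ?case using Suc by simp
qed simp

lemma zeta_nat_sums:
  assumes "k \<ge> 2"
  shows "(\<lambda>n. (1 / real (n + 1)) ^ k) sums zeta_nat k"
proof -
  have "summable (\<lambda>n. inverse (real n ^ k))"
    using inverse_power_summable[OF assms, where 'a = real] by simp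
  then have "summable (\<lambda>n. 1 / real (n + 1) ^ k)"
    by (subst (asm) summable_iff_shift[symmetric, of _ 1]) (simp add: field_simps)
  then show ?thesis
    unfolding zeta_nat_def by (simp add: summable_sums power_one_over)
qed

lemma zeta_nat_tail_sums:
  assumes "k \<ge> 2"
  shows "(\<lambda>n. (1 / real (n + 2)) ^ k) sums (zeta_nat k - 1)"
  using sums_split_initial_segment[OF zeta_nat_sums[OF assms], of 1] by (simp add: add_ac)

lemma telescoping_reciprocal_sums:
  "(\<lambda>n. 1 / real (n + 1) - 1 / real (n + 2)) sums 1"
proof -
  have "(\<lambda>n. 1 / real (Suc n)) \<longlonglongrightarrow> 0"
    using LIMSEQ_inverse_real_of_nat by (simp add: inverse_eq_divide)
  from telescope_sums'[OF this] show ?thesis by (simp add: add_ac)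
qed

text \<open>The two first-power terms have opposite coefficients and join to a telescoping series
  with sum 1, so no divergent harmonic series occurs. Its coefficient
  \<open>(a + b) choose a\<close> and the hockey-stick correction
  \<open>(a + b) choose Suc a\<close> add up to the last binomial.\<close>

lemma mixed_reciprocal_powers_sums:
  "(\<lambda>n. (1 / real (n + 1)) ^ Suc a * (1 / real (n + 2)) ^ Suc b) sums
   ((\<Sum>k=1..a. (-1) ^ (a + k) * real ((a + b - k) choose b) * zeta_nat (Suc k))
    - (-1) ^ a * (\<Sum>k=1..b. real ((a + b - k) choose a) * zeta_nat (Suc k))
    + (-1) ^ a * real (Suc (a + b) choose Suc a))"
proof -
  define u v where "u n = 1 / real (n + 1)" and "v n = 1 / real (n + 2)" for n
  have uv: "u n - v n = u n * v n" for n
    unfolding u_def v_def by (simp add: field_simps)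
  have sym: "(a + b) choose b = (a + b) choose a"
    using binomial_symmetric[of b "a + b"] by simp
  have "u n ^ Suc a * v n ^ Suc b =
      (\<Sum>k=1..a. (-1) ^ (a + k) * real ((a + b - k) choose b) * u n ^ Suc k)
      - (-1) ^ a * (\<Sum>k=1..b. real ((a + b - k) choose a) * v n ^ Suc k)
      + (-1) ^ a * real ((a + b) choose a) * (u n - v n)" for n
    unfolding partial_fraction[OF uv]
    by (simp add: sum.atLeast_Suc_atMost[of 0] sym algebra_simps del: power_Suc)
  then have eq: "(\<lambda>n. u n ^ Suc a * v n ^ Suc b) = (\<lambda>n.
      (\<Sum>k=1..a. (-1) ^ (a + k) * real ((a + b - k) choose b) * u n ^ Suc k)
      - (-1) ^ a * (\<Sum>k=1..b. real ((a + b - k) choose a) * v n ^ Suc k)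
      + (-1) ^ a * real ((a + b) choose a) * (u n - v n))" ..
  have "(\<lambda>n. u n ^ Suc a * v n ^ Suc b) sums
     ((\<Sum>k=1..a. (-1) ^ (a + k) * real ((a + b - k) choose b) * zeta_nat (Suc k))
      - (-1) ^ a * (\<Sum>k=1..b. real ((a + b - k) choose a) * (zeta_nat (Suc k) - 1))
      + (-1) ^ a * real ((a + b) choose a) * 1)"
    unfolding eq unfolding u_def v_def
    by (intro sums_add sums_diff sums_mult sums_sum zeta_nat_sums zeta_nat_tail_sums
        telescoping_reciprocal_sums) auto
  also have "(\<Sum>k=1..b. real ((a + b - k) choose a) * (zeta_nat (Suc k) - 1))
      = (\<Sum>k=1..b. real ((a + b - k) choose a) * zeta_nat (Suc k)) - real ((a + b) choose Suc a)"
    by (simp add: sum_choose_shifted_diagonal[symmetric] sum_subtractf algebra_simps)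
  finally show ?thesis
    unfolding u_def v_def by (simp add: algebra_simps)
qed

section \<open>Series with the factor \<open>1 / (2 * n + 3)^2\<close>\<close>

text \<open>Grouping the Basel series in pairs and removing the even squares, a quarter of the
  whole, leaves \<open>pi^2/8\<close>; then the term 1 is dropped.\<close>

lemma odd_inverse_squares_sums:
  "(\<lambda>n. 1 / (2 * real n + 3)\<^sup>2) sums (pi\<^sup>2 / 8 - 1)"
proof -
  have all: "(\<lambda>n. 1 / (real n + 1)\<^sup>2) sums (pi\<^sup>2 / 6)"
    using inverse_squares_sums by (simp add: add_ac)
  have "(\<lambda>n. \<Sum>i\<in>{n * 2..<n * 2 + 2}. 1 / (real i + 1)\<^sup>2) sums (pi\<^sup>2 / 6)"
    using sums_group[OF all, of 2] by simp
  also have "(\<lambda>n. \<Sum>i\<in>{n * 2..<n * 2 + 2}. 1 / (real i + 1)\<^sup>2)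
      = (\<lambda>n. 1 / (2 * real n + 1)\<^sup>2 + 1 / (2 * real n + 2)\<^sup>2)"
    by (simp add: eval_nat_numeral add_ac mult_ac)
  finally have pairs:
    "(\<lambda>n. 1 / (2 * real n + 1)\<^sup>2 + 1 / (2 * real n + 2)\<^sup>2) sums (pi\<^sup>2 / 6)" .
  have "(\<lambda>n. 1 / 4 * (1 / (real n + 1)\<^sup>2)) sums (1 / 4 * (pi\<^sup>2 / 6))"
    by (intro sums_mult all)
  moreover have "1 / 4 * (1 / (real n + 1)\<^sup>2) = 1 / (2 * real n + 2)\<^sup>2" for n
  proof -
    have "2 * real n + 2 = 2 * (real n + 1)" by simp
    then show ?thesis by (simp only: power_mult_distrib) simp
  qed
  ultimately have "(\<lambda>n. 1 / (2 * real n + 2)\<^sup>2) sums (1 / 4 * (pi\<^sup>2 / 6))"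
    by simp
  from sums_diff[OF pairs this] have "(\<lambda>n. 1 / (2 * real n + 1)\<^sup>2) sums (pi\<^sup>2 / 8)"
    by simp
  from sums_split_initial_segment[OF this, of 1] show ?thesis
    by (simp add: add_ac)
qed

text \<open>Splitting off the summand \<open>i = 0\<close> and shifting the rest gives a recurrence
  that mirrors the factor 4 in \<open>w * q = w - 4 * q\<close>.\<close>

lemma beta_coeff_Suc:
  assumes "k \<le> p"
  shows "beta_coeff (Suc p) k = real ((2 * p - k) choose p) + 4 * beta_coeff p k"
proof -
  have "Suc p - k = Suc (p - k)" using assms by simp
  moreover have "2 * Suc p - 2 * Suc i - k - 2 = 2 * p - 2 * i - k - 2" for i by simp
  ultimately show ?thesis
    unfolding beta_coeff_def
    by (simp add: sum.lessThan_Suc_shift sum_distrib_left mult_ac del: sum.lessThan_Suc)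
qed

lemma beta_coeff_eq_0: "p \<le> k \<Longrightarrow> beta_coeff p k = 0"
  by (simp add: beta_coeff_def)

text \<open>The induction step for the binomial constant in the next lemma. It follows from
  \<open>2p + 3 = 1 + 2(p + 1)\<close> and the absorption identity.\<close>

lemma central_binomial_recurrence:
  "(real p + 3 / 2) * real ((2 * Suc p) choose Suc p)
   = real (Suc (p + p) choose Suc p) + 4 * ((real p + 1 / 2) * real ((2 * p) choose p))"
proof -
  have sym: "Suc (p + p) choose p = Suc (p + p) choose Suc p"
    using binomial_symmetric[of p "Suc (p + p)"] by simp
  have 1: "(2 * Suc p) choose Suc p = 2 * (Suc (p + p) choose Suc p)"
    using sym by (simp add: mult_2)
  have "Suc p * (Suc (p + p) choose Suc p) = Suc (p + p) * ((p + p) choose p)"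
    using Suc_times_binomial by metis
  then have "real (Suc p) * real (Suc (p + p) choose Suc p)
      = real (Suc (p + p)) * real ((p + p) choose p)"
    by (metis of_nat_mult)
  then show ?thesis unfolding 1 mult_2[of p] by (simp add: algebra_simps)
qed

text \<open>Each step of the induction adds the mixed sum with both exponents \<open>Suc p\<close>
  and multiplies the previous value by -4. At \<open>p = 0\<close> the two halves combine to the 1
  in \<open>pi^2/8 - 1\<close>.\<close>

lemma reciprocal_powers_times_odd_square_sums:
  "(\<lambda>n. (1 / real (n + 1) * (1 / real (n + 2))) ^ p * (1 / (2 * real n + 3)\<^sup>2)) sums
   ((-1) ^ Suc p *
     (- (\<Sum>k=1..p. (1 + (-1) ^ Suc k) * beta_coeff p k * zeta_nat (Suc k))
      + (real p + 1 / 2) * real ((2 * p) choose p) - (pi\<^sup>2 / 8 - 1 / 2) * 4 ^ p))"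
proof (induction p)
  case 0
  show ?case using odd_inverse_squares_sums by simp
next
  case (Suc p)
  define w q where "w n = 1 / real (n + 1) * (1 / real (n + 2))"
    and "q n = 1 / (2 * real n + 3)\<^sup>2" for n
  define Z where "Z = (\<Sum>k=1..p. (1 + (-1) ^ Suc k) * real ((2 * p - k) choose p) * zeta_nat (Suc k))"
  define B where "B = (\<Sum>k=1..p. (1 + (-1) ^ Suc k) * beta_coeff p k * zeta_nat (Suc k))"
  \<comment> \<open>This is \<open>(2n+3)^2 - 4(n+1)(n+2) = 1\<close> after division by both
    products.\<close>
  have wq: "w n * q n = w n - 4 * q n" for n
    unfolding w_def q_def by (simp add: divide_simps) (simp add: algebra_simps power2_eq_square)
  have "w n ^ Suc p * q n = (1 / real (n + 1)) ^ Suc p * (1 / real (n + 2)) ^ Suc p - 4 * (w n ^ p * q n)" for n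
  proof -
    have "w n ^ Suc p * q n = w n ^ p * (w n * q n)" by simp
    also have "\<dots> = w n ^ Suc p - 4 * (w n ^ p * q n)"
      unfolding wq by (simp add: algebra_simps)
    finally show ?thesis unfolding w_def power_mult_distrib .
  qed
  then have eq: "(\<lambda>n. w n ^ Suc p * q n)
      = (\<lambda>n. (1 / real (n + 1)) ^ Suc p * (1 / real (n + 2)) ^ Suc p - 4 * (w n ^ p * q n))" ..
  have IH: "(\<lambda>n. w n ^ p * q n) sums
    ((-1) ^ Suc p * (- B + (real p + 1 / 2) * real ((2 * p) choose p) - (pi\<^sup>2 / 8 - 1 / 2) * 4 ^ p))"
    using Suc.IH unfolding w_def q_def B_def .
  \<comment> \<open>For equal exponents both families have the same binomials, so the sign
    \<open>(-1)^k - 1\<close> remains and only zeta values at even arguments survive.\<close>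
  have Z: "(\<Sum>k=1..p. (-1) ^ (p + k) * real ((p + p - k) choose p) * zeta_nat (Suc k))
      - (-1) ^ p * (\<Sum>k=1..p. real ((p + p - k) choose p) * zeta_nat (Suc k)) = - ((-1) ^ p * Z)"
    unfolding Z_def
    by (simp add: sum_distrib_left sum_subtractf[symmetric] sum_negf[symmetric] power_add mult_2
        mult_2_right algebra_simps cong: sum.cong)
  have "(\<Sum>k=1..Suc p. (1 + (-1) ^ Suc k) * beta_coeff (Suc p) k * zeta_nat (Suc k))
      = (\<Sum>k=1..p. (1 + (-1) ^ Suc k) * beta_coeff (Suc p) k * zeta_nat (Suc k))"
    by (simp add: beta_coeff_eq_0)
  also have "\<dots> = (\<Sum>k=1..p. (1 + (-1) ^ Suc k) * real ((2 * p - k) choose p) * zeta_nat (Suc k)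
        + 4 * ((1 + (-1) ^ Suc k) * beta_coeff p k * zeta_nat (Suc k)))"
    by (intro sum.cong refl) (simp add: beta_coeff_Suc algebra_simps)
  also have "\<dots> = Z + 4 * B"
    unfolding Z_def B_def by (simp only: sum.distrib sum_distrib_left)
  finally have ZB: "(\<Sum>k=1..Suc p. (1 + (-1) ^ Suc k) * beta_coeff (Suc p) k * zeta_nat (Suc k))
      = Z + 4 * B" .
  have "(real (Suc p) + 1 / 2) * real ((2 * Suc p) choose Suc p)
      = real (Suc (p + p) choose Suc p) + 4 * ((real p + 1 / 2) * real ((2 * p) choose p))"
    using central_binomial_recurrence[of p] by (simp add: add_ac)
  \<comment> \<open>Linear identity with \<open>e = (-1) ^ p\<close> and \<open>f = 4 ^ p\<close>,
    its products left unsimplified to match what \<open>power_Suc\<close> produces.\<close>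
  moreover have "- (e * Z) + e * c - 4 * (- 1 * e * (- B + d - g * f))
      = - 1 * (- 1 * e) * (- (Z + 4 * B) + c' - g * (4 * f))" if "c' = c + 4 * d" for c c' d e f g :: real
    using that by (simp add: algebra_simps)
  ultimately have "- ((-1) ^ p * Z) + (-1) ^ p * real (Suc (p + p) choose Suc p)
      - 4 * ((-1) ^ Suc p * (- B + (real p + 1 / 2) * real ((2 * p) choose p) - (pi\<^sup>2 / 8 - 1 / 2) * 4 ^ p))
    = (-1) ^ Suc (Suc p) * (- (Z + 4 * B)
      + (real (Suc p) + 1 / 2) * real ((2 * Suc p) choose Suc p) - (pi\<^sup>2 / 8 - 1 / 2) * 4 ^ Suc p)"
    by (simp only: power_Suc)
  then show ?case
    using sums_diff[OF mixed_reciprocal_powers_sums[of p p] sums_mult[OF IH, of 4]]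
    unfolding ZB Z eq[symmetric] by (simp only: w_def q_def)
qed

section \<open>Closed form of \<open>inv_ztilde\<close>\<close>

lemma zseq_diff: "zseq i - zseq k = (real i - real k) * (real i + real k + 1)"
  by (simp add: zseq_def algebra_simps)

text \<open>Widening the gap from \<open>m\<close> to \<open>m + 1\<close> adds a telescoping series
  with sum \<open>1/(m+1)\<close>.\<close>

lemma telescoping_gap_sums:
  "(\<lambda>j. 1 / real (j + 1) - 1 / real (j + 1 + m)) sums (\<Sum>i=1..m. 1 / real i)"
proof (induction m)
  case (Suc m)
  have "(\<lambda>n. 1 / real (n + Suc m)) \<longlonglongrightarrow> 0"
    using LIMSEQ_ignore_initial_segment[OF lim_1_over_n, of "Suc m"] by simp
  from sums_add[OF Suc telescope_sums'[OF this]] show ?case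
    by (simp add: add_ac)
qed simp

text \<open>With \<open>i = j + k + 1\<close> the factors of \<open>zseq i - zseq k\<close> are
  \<open>j + 1\<close> and \<open>j + 2k + 2\<close>, which differ by the gap \<open>2k + 1\<close>.
  The series of \<open>1 / zseq i\<close> telescopes to \<open>1/(k+1)\<close>.\<close>

lemma inv_ztilde_term_sums:
  "(\<lambda>j. inv_ztilde_term k (j + k + 1)) sums
   ((\<Sum>i=1..2 * k + 1. 1 / real i) / (2 * real k + 1) - 1 / (real k + 1))"
proof -
  have "(\<lambda>n. 1 / real (n + Suc k)) \<longlonglongrightarrow> 0"
    using LIMSEQ_ignore_initial_segment[OF lim_1_over_n, of "Suc k"] by simp
  from sums_diff[OF sums_divide[OF telescoping_gap_sums[of "2 * k + 1"], of "2 * real k + 1"]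
      telescope_sums'[OF this]]
  have "(\<lambda>j. (1 / real (j + 1) - 1 / real (j + 1 + (2 * k + 1))) / (2 * real k + 1)
        - (1 / real (j + Suc k) - 1 / real (Suc j + Suc k))) sums
      ((\<Sum>i=1..2 * k + 1. 1 / real i) / (2 * real k + 1) - 1 / (real k + 1))"
    by (simp add: add_ac)
  moreover have "inv_ztilde_term k (j + k + 1)
    = (1 / real (j + 1) - 1 / real (j + 1 + (2 * k + 1))) / (2 * real k + 1)
        - (1 / real (j + Suc k) - 1 / real (Suc j + Suc k))" for j
  proof -
    have "1 / (zseq (j + k + 1) - zseq k)
        = (1 / real (j + 1) - 1 / real (j + 1 + (2 * k + 1))) / (2 * real k + 1)"
      unfolding zseq_diff by (simp add: divide_simps) (simp add: algebra_simps)
    moreover have "1 / zseq (j + k + 1) = 1 / real (j + Suc k) - 1 / real (Suc j + Suc k)"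
      unfolding zseq_def by (simp add: divide_simps)
    ultimately show ?thesis unfolding inv_ztilde_term_def by simp
  qed
  ultimately show ?thesis by simp
qed

lemma inv_ztilde_finite_part:
  "(\<Sum>i\<in>{1..<Suc m}. 1 / (zseq i - zseq (Suc m)))
   = - ((\<Sum>i=1..m. 1 / real i) + (\<Sum>i=1..m. 1 / real (i + m + 2))) / (2 * real m + 3)"
proof -
  have "(\<Sum>i\<in>{1..<Suc m}. 1 / (zseq i - zseq (Suc m)))
      = (\<Sum>i=1..m. - (1 / real (m + 1 - i) + 1 / real (i + m + 2)) / (2 * real m + 3))"
  proof (intro sum.cong)
    fix i assume "i \<in> {1..m}"
    \<comment> \<open>\<open>d\<close> is the distance \<open>k - i\<close> for
      \<open>k = m + 1\<close>; it removes the truncated subtraction.\<close>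
    then obtain d where d: "m + 1 = i + d" "d > 0" 
      by (metis atLeastAtMost_iff less_Suc_eq_le less_imp_add_positive Suc_eq_plus1)
    then have rd: "real m = real i + real d - 1" by linarith
    show "1 / (zseq i - zseq (Suc m)) = - (1 / real (m + 1 - i) + 1 / real (i + m + 2)) / (2 * real m + 3)"
      using d unfolding zseq_diff by (simp add: rd divide_simps) (auto simp: algebra_simps)
  qed auto
  also have "\<dots> = - ((\<Sum>i=1..m. 1 / real (m + 1 - i)) + (\<Sum>i=1..m. 1 / real (i + m + 2))) / (2 * real m + 3)"
    by (simp add: sum_divide_distrib[symmetric] sum.distrib sum_subtractf sum_negf)
  also have "(\<Sum>i=1..m. 1 / real (m + 1 - i)) = (\<Sum>i=1..m. 1 / real i)"
    by (subst sum.atLeastAtMost_rev) simp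
  finally show ?thesis .
qed

text \<open>The finite part cancels the harmonic sum up to \<open>2k + 1\<close> except for
  \<open>1/k\<close>, \<open>1/(k+1)\<close> and \<open>1/(2k+1)\<close>. Divided by
  \<open>2k + 1\<close>, the first two give \<open>1/k - 1/(k+1)\<close> and the third gives the
  square.\<close>

lemma inv_ztilde_eq:
  assumes "k \<ge> 1"
  shows "inv_ztilde k = 1 / real k - 2 / (real k + 1) + 1 / (2 * real k + 1)\<^sup>2"
proof -
  obtain m where k: "k = Suc m" using assms by (cases k) auto
  have range: "2 * k + 1 = m + 2 + (m + 1)" by (simp add: k)
  have "(\<Sum>i=1..2 * k + 1. 1 / real i)
      = (\<Sum>i=1..m + 2. 1 / real i) + (\<Sum>i=m + 2 + 1..m + 2 + (m + 1). 1 / real i)"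
    unfolding range by (rule sum.ub_add_nat) simp
  also have "(\<Sum>i=m + 2 + 1..m + 2 + (m + 1). 1 / real i) = (\<Sum>i=1..m + 1. 1 / real (i + (m + 2)))"
    by (simp only: add.commute[of "m + 2"] sum.shift_bounds_cl_nat_ivl)
  finally have H: "(\<Sum>i=1..2 * k + 1. 1 / real i) = (\<Sum>i=1..m. 1 / real i)
      + (\<Sum>i=1..m. 1 / real (i + m + 2)) + 1 / (real m + 1) + 1 / (real m + 2) + 1 / (2 * real m + 3)"
    by (simp add: add_ac)
  define S where "S = (\<Sum>i=1..m. 1 / real i) + (\<Sum>i=1..m. 1 / real (i + m + 2))"
  have "inv_ztilde k = - S / (2 * real m + 3)
      + ((S + 1 / (real m + 1) + 1 / (real m + 2) + 1 / (2 * real m + 3)) / (2 * real k + 1)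
          - 1 / (real k + 1))"
    unfolding inv_ztilde_def sums_unique[OF inv_ztilde_term_sums, symmetric] H S_def
    unfolding k inv_ztilde_finite_part by simp
  also have "\<dots> = (1 / (real m + 1) + 1 / (real m + 2)) / (2 * real m + 3)
      + 1 / (2 * real m + 3)\<^sup>2 - 1 / (real m + 2)"
    by (simp add: k add_divide_distrib power2_eq_square add_ac)
  also have "(1 / (real m + 1) + 1 / (real m + 2)) / (2 * real m + 3)
      = 1 / (real m + 1) - 1 / (real m + 2)"
    by (simp add: divide_simps)
  finally show ?thesis by (simp add: k add_ac)
qed

section \<open>Evaluation of \<open>zeta_tilde\<close>\<close>

text \<open>The closed form \<open>u - 2v + q\<close> times \<open>(uv)^(s-1)\<close> splits the
  series into two mixed sums and one sum with \<open>q\<close>; their coefficients are then matched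
  with \<open>mu_coeff\<close> and \<open>eta_coeff\<close>.\<close>

lemma zeta_tilde_term_sums:
  assumes "s \<ge> 2"
  shows "(\<lambda>j. zeta_tilde_term s (j + 1)) sums
    ((-1) ^ s * ((\<Sum>k=2..s. mu_coeff s k * zeta_nat k) + eta_coeff s))"
proof -
  obtain t where s: "s = Suc (Suc t)" using assms by (metis Suc_le_D numeral_2_eq_2 Suc_le_mono)
  define p where "p = Suc t"
  \<comment> \<open>These are the two binomials in \<open>mu_coeff s (Suc k)\<close>.\<close>
  define C1 C2 where "C1 k = real ((2 * t + 1 - k) choose t)"
    and "C2 k = real ((2 * t + 1 - k) choose p)" for k
  let ?u = "\<lambda>n. 1 / real (n + 1)" and ?v = "\<lambda>n. 1 / real (n + 2)"
  let ?w = "\<lambda>n. ?u n * ?v n"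
  have term_eq: "zeta_tilde_term s (n + 1) = ?u n ^ Suc p * ?v n ^ Suc t
      - 2 * (?u n ^ Suc t * ?v n ^ Suc p) + ?w n ^ p * (1 / (2 * real n + 3)\<^sup>2)" for n
  proof -
    have "zeta_tilde_term s (n + 1) = (?u n - 2 * ?v n + 1 / (2 * real n + 3)\<^sup>2) * ?w n ^ p"
      unfolding zeta_tilde_term_def
      by (simp add: inv_ztilde_eq s p_def zseq_def add_ac power_mult_distrib
          divide_inverse power_inverse)
    moreover have "(x - 2 * y + r) * (x * y) ^ Suc t
        = x ^ Suc (Suc t) * y ^ Suc t - 2 * (x ^ Suc t * y ^ Suc (Suc t)) + (x * y) ^ Suc t * r"
      for x y r :: real
      by (simp add: power_mult_distrib algebra_simps)
    ultimately show ?thesis unfolding p_def by (simp only:)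
  qed
  \<comment> \<open>\<open>C2 p = 0\<close>, since it is \<open>t choose Suc t\<close>; so all sums
    can run to \<open>p\<close>.\<close>
  have C2_sum: "(\<Sum>k=1..t. C2 k * x k) = (\<Sum>k=1..p. C2 k * x k)" for x
    by (simp add: p_def C2_def)
  have index: "p + t - k = 2 * t + 1 - k" "t + p - k = 2 * t + 1 - k"
    "Suc (p + t) = 2 * p" "Suc (t + p) = 2 * p" for k
    by (simp_all add: p_def)
  have T1: "(\<lambda>n. ?u n ^ Suc p * ?v n ^ Suc t) sums
      ((\<Sum>k=1..p. (-1) ^ (p + k) * C1 k * zeta_nat (Suc k))
       - (-1) ^ p * (\<Sum>k=1..p. C2 k * zeta_nat (Suc k))
       + (-1) ^ p * real ((2 * p) choose Suc p))"
    using mixed_reciprocal_powers_sums[of p t]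
    unfolding index C1_def[symmetric] C2_def[symmetric] C2_sum .
  have T2: "(\<lambda>n. ?u n ^ Suc t * ?v n ^ Suc p) sums
      ((\<Sum>k=1..p. C2 k * ((-1) ^ (t + k) * zeta_nat (Suc k)))
       - (-1) ^ t * (\<Sum>k=1..p. C1 k * zeta_nat (Suc k))
       + (-1) ^ t * real ((2 * p) choose Suc t))"
    using mixed_reciprocal_powers_sums[of t p]
    unfolding index C1_def[symmetric] C2_def[symmetric] C2_sum[symmetric] by (simp only: mult_ac)
  have "mu_coeff s (Suc k) = ((-1) ^ Suc k + 2) * (C1 k + (-1) ^ Suc k * C2 k)
      - (1 + (-1) ^ Suc k) * beta_coeff p k" for k
    unfolding mu_coeff_def C1_def C2_def by (simp add: s p_def)
  then have "(\<Sum>k=2..s. mu_coeff s k * zeta_nat k) = (\<Sum>k=1..p.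
      (((-1) ^ Suc k + 2) * (C1 k + (-1) ^ Suc k * C2 k)
      - (1 + (-1) ^ Suc k) * beta_coeff p k) * zeta_nat (Suc k))"
    using sum.shift_bounds_cl_Suc_ivl[of "\<lambda>k. mu_coeff s k * zeta_nat k" 1 p]
    by (simp add: s p_def numeral_2_eq_2)
  \<comment> \<open>Multiplying out, the two signs before \<open>C2\<close> cancel in one product;
    this leaves plain and alternating sums of \<open>C1\<close> and \<open>C2\<close>.\<close>
  then have mu: "(\<Sum>k=2..s. mu_coeff s k * zeta_nat k) =
      2 * (\<Sum>k=1..p. C1 k * zeta_nat (Suc k)) + (\<Sum>k=1..p. C2 k * zeta_nat (Suc k))
      - (\<Sum>k=1..p. (-1) ^ k * C1 k * zeta_nat (Suc k))
      - 2 * (\<Sum>k=1..p. (-1) ^ k * C2 k * zeta_nat (Suc k))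
      - (\<Sum>k=1..p. (1 + (-1) ^ Suc k) * beta_coeff p k * zeta_nat (Suc k))"
    unfolding sum_distrib_left sum_subtractf[symmetric] sum.distrib[symmetric]
    by (auto intro!: sum.cong simp: algebra_simps simp flip: power_add)
  have eta: "eta_coeff s = (real p + 1 / 2) * real ((2 * p) choose p) - real ((2 * p) choose Suc p)
      - 2 * real ((2 * p) choose Suc t) - (pi\<^sup>2 / 8 - 1 / 2) * 4 ^ p"
  proof -
    have idx: "2 * s - 2 = 2 * p" "s - 1 = p" "2 * s - 3 = Suc (t + t)" "s - 2 = t" "s = Suc p"
      "real s - 1 / 2 = real p + 1 / 2"
      by (simp_all add: s p_def)
    \<comment> \<open>The central binomial is twice its neighbour in the row above, which turns the
      constant of the second series into the term with factor 4 in \<open>eta_coeff\<close>.\<close>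
    have "Suc (t + t) choose t = Suc (t + t) choose Suc t"
      using binomial_symmetric[of t "Suc (t + t)"] by simp
    moreover have "2 * p = Suc (Suc (t + t))" by (simp add: p_def)
    ultimately have "4 * real (Suc (t + t) choose t) = 2 * real ((2 * p) choose Suc t)"
      by simp
    then show ?thesis
      unfolding eta_coeff_def idx(1-4) idx(6) by (simp add: idx(5) power_mult)
  qed
  have sgn1: "(\<Sum>k=1..p. (-1) ^ (p + k) * C1 k * zeta_nat (Suc k))
      = (-1) ^ p * (\<Sum>k=1..p. (-1) ^ k * C1 k * zeta_nat (Suc k))"
    by (simp add: power_add sum_distrib_left mult_ac)
  have sgn2: "(\<Sum>k=1..p. C2 k * ((-1) ^ (t + k) * zeta_nat (Suc k)))
      = (-1) ^ t * (\<Sum>k=1..p. (-1) ^ k * C2 k * zeta_nat (Suc k))"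
    by (simp add: power_add sum_distrib_left mult_ac)
  let ?a1 = "\<Sum>k=1..p. C1 k * zeta_nat (Suc k)"
  let ?a2 = "\<Sum>k=1..p. C2 k * zeta_nat (Suc k)"
  let ?b1 = "\<Sum>k=1..p. (-1) ^ k * C1 k * zeta_nat (Suc k)"
  let ?b2 = "\<Sum>k=1..p. (-1) ^ k * C2 k * zeta_nat (Suc k)"
  let ?B = "\<Sum>k=1..p. (1 + (-1) ^ Suc k) * beta_coeff p k * zeta_nat (Suc k)"
  have sgn_s: "(-1::real) ^ s = (-1) ^ t" and sgn_p: "(-1::real) ^ p = - ((-1) ^ t)"
    by (simp_all add: s p_def)
  \<comment> \<open>Here \<open>e = (-1) ^ t\<close>; the \<open>a\<close>s are plain sums, the
    \<open>b\<close>s alternating ones, and the \<open>c\<close>s constants.\<close>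
  have "- e * b1 - - e * a2 + - e * c1 - 2 * (e * b2 - e * a1 + e * c2) + - 1 * - e * (- B + c3 - c4)
      = e * (2 * a1 + a2 - b1 - 2 * b2 - B + (c3 - c1 - 2 * c2 - c4))"
    for e a1 a2 b1 b2 B c1 c2 c3 c4 :: real
    by (simp add: algebra_simps)
  from this[of "(-1) ^ t" ?b1 ?a2 "real ((2 * p) choose Suc p)" ?b2 ?a1
      "real ((2 * p) choose Suc t)" ?B "(real p + 1 / 2) * real ((2 * p) choose p)"
      "(pi\<^sup>2 / 8 - 1 / 2) * 4 ^ p"]
  show ?thesis
    using sums_add[OF sums_diff[OF T1 sums_mult[OF T2, of 2]]
        reciprocal_powers_times_odd_square_sums[of p]]
    unfolding term_eq mu eta sgn1 sgn2 sgn_s power_Suc[of "-1::real" p] sgn_p by (simp only:)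
qed

theorem theorem4p4:
  shows "(\<forall>k\<ge>1.
            summable (\<lambda>j. inv_ztilde_term k (j + k + 1)) \<and>
            inv_ztilde k = 1 / real k - 2 / (real k + 1) + 1 / (2 * real k + 1)\<^sup>2)
       \<and> (\<forall>s\<ge>2.
            summable (\<lambda>j. zeta_tilde_term s (j + 1)) \<and>
            zeta_tilde s = (-1) ^ s * ((\<Sum>k=2..s. mu_coeff s k * zeta_nat k) + eta_coeff s))"
proof (intro conjI allI impI)
  fix k :: nat assume "k \<ge> 1"
  show "summable (\<lambda>j. inv_ztilde_term k (j + k + 1))"
    using inv_ztilde_term_sums by (rule sums_summable)
  show "inv_ztilde k = 1 / real k - 2 / (real k + 1) + 1 / (2 * real k + 1)\<^sup>2"
    using \<open>k \<ge> 1\<close> by (rule inv_ztilde_eq)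
next
  fix s :: nat assume "s \<ge> 2"
  note sums = zeta_tilde_term_sums[OF this]
  show "summable (\<lambda>j. zeta_tilde_term s (j + 1))"
    using sums by (rule sums_summable)
  show "zeta_tilde s = (-1) ^ s * ((\<Sum>k=2..s. mu_coeff s k * zeta_nat k) + eta_coeff s)"
    unfolding zeta_tilde_def using sums by (rule sums_unique[symmetric])
qed

end
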